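(* $gr^3_2(B_{15})=25$.
   Context: $K_n$ is the complete graph of order $n$. The book $B_n:=K_2+nK_1$ (graph join) is the graph on $n+2$ vertices consisting of an edge $xy$ (the spine) together with $n$ further, pairwise non-adjacent vertices (the pages), each adjacent to both $x$ and $y$. A $t$-coloring of $K_p$ is a map $f:E(K_p)\to\{1,\dots,t\}$, not assumed surjective. A Gallai $t$-coloring is a $t$-coloring with no rainbow triangle, i.e. there are no three vertices $x,y,z$ such that $f(xy),f(xz),f(yz)$ are pairwise distinct. For $1\le s<t$ and a graph $G$, the weakened Gallai-Ramsey number $gr^t_s(G)$ is the least $p\in\mathbb{N}$ such that every Gallai $t$-coloring of $K_p$ contains a (not necessarily induced) subgraph isomorphic to $G$ whose edges use at most $s$ colors. *)

theory Defs
  imports Main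
begin

text \<open>A graph is a pair of a vertex set and a set of edges, the edges being two-element sets of
  vertices.\<close>

type_synonym 'a ugraph = "'a set \<times> 'a set set"

abbreviation verts :: "'a ugraph \<Rightarrow> 'a set" where
  "verts G \<equiv> fst G"

abbreviation edges :: "'a ugraph \<Rightarrow> 'a set set" where
  "edges G \<equiv> snd G"

definition simple_graph :: "'a ugraph \<Rightarrow> bool" where
  "simple_graph G \<longleftrightarrow> (\<forall>e\<in>edges G. e \<subseteq> verts G \<and> card e = 2)"

definition complete_graph :: "nat \<Rightarrow> nat ugraph" where
  "complete_graph n = ({..<n}, {{u, v} | u v. u < n \<and> v < n \<and> u \<noteq> v})"

definition empty_graph :: "nat \<Rightarrow> nat ugraph" where
  "empty_graph n = ({..<n}, {})"

definition graph_join :: "'a ugraph \<Rightarrow> 'b ugraph \<Rightarrow> ('a + 'b) ugraph" where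
  "graph_join G H =
     (Inl ` verts G \<union> Inr ` verts H,
      (`) Inl ` edges G \<union> (`) Inr ` edges H \<union> {{Inl u, Inr v} | u v. u \<in> verts G \<and> v \<in> verts H})"

definition book :: "nat \<Rightarrow> (nat + nat) ugraph" where
  "book n = graph_join (complete_graph 2) (empty_graph n)"

definition subgraph :: "'a ugraph \<Rightarrow> 'a ugraph \<Rightarrow> bool" where
  "subgraph H G \<longleftrightarrow> simple_graph H \<and> verts H \<subseteq> verts G \<and> edges H \<subseteq> edges G"

definition isomorphic :: "'a ugraph \<Rightarrow> 'b ugraph \<Rightarrow> bool" where
  "isomorphic G H \<longleftrightarrow>
     (\<exists>\<phi>. bij_betw \<phi> (verts G) (verts H) \<and> edges H = (`) \<phi> ` edges G)"

text \<open>A coloring is a total function on sets of vertices; only its values on the edges of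
  \<^term>\<open>complete_graph p\<close> matter.\<close>

definition coloring :: "nat \<Rightarrow> nat \<Rightarrow> (nat set \<Rightarrow> nat) \<Rightarrow> bool" where
  "coloring t p f \<longleftrightarrow> (\<forall>e\<in>edges (complete_graph p). f e \<in> {1..t})"

definition rainbow_triangle :: "nat \<Rightarrow> (nat set \<Rightarrow> nat) \<Rightarrow> bool" where
  "rainbow_triangle p f \<longleftrightarrow>
     (\<exists>x\<in>verts (complete_graph p). \<exists>y\<in>verts (complete_graph p). \<exists>z\<in>verts (complete_graph p).
        x \<noteq> y \<and> x \<noteq> z \<and> y \<noteq> z \<and>
        f {x, y} \<noteq> f {x, z} \<and> f {x, y} \<noteq> f {y, z} \<and> f {x, z} \<noteq> f {y, z})"

definition gallai_coloring :: "nat \<Rightarrow> nat \<Rightarrow> (nat set \<Rightarrow> nat) \<Rightarrow> bool" where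
  "gallai_coloring t p f \<longleftrightarrow> coloring t p f \<and> \<not> rainbow_triangle p f"

definition contains_colored_copy :: "nat \<Rightarrow> nat \<Rightarrow> (nat set \<Rightarrow> nat) \<Rightarrow> 'a ugraph \<Rightarrow> bool" where
  "contains_colored_copy s p f G \<longleftrightarrow>
     (\<exists>H. subgraph H (complete_graph p) \<and> isomorphic G H \<and> card (f ` edges H) \<le> s)"

text \<open>If no such \<open>p\<close> exists, the value below is unspecified. The definition is meant for
  \<open>1 \<le> s < t\<close>.\<close>

definition weakened_gallai_ramsey :: "nat \<Rightarrow> nat \<Rightarrow> 'a ugraph \<Rightarrow> nat" where
  "weakened_gallai_ramsey t s G =
     (LEAST p. \<forall>f. gallai_coloring t p f \<longrightarrow> contains_colored_copy s p f G)"

end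

theory Submission
  imports Defs
begin

text \<open>For an edge of color \<open>j\<close> and a color \<open>i \<noteq> j\<close>, the vertices joined to one of its ends in color
  \<open>i\<close> are exactly those that are not pages of a book avoiding \<open>i\<close>. So a Gallai 3-coloring of \<open>K\<^sub>2\<^sub>5\<close>
  without the required book has at least 9 such vertices for every edge and every color missing on
  it. Some color is disconnected, and its components are joined pairwise in single colors; counting
  over four or five components forces a cut of the vertex set all of whose edges have one color. The
  smaller side of the cut has at most 12 vertices, and counting two-colored triangles shows that it
  misses the other two colors, hence is a single vertex. Deleting this vertex leaves 24 vertices that
  again have such a cut, and degrees on its smaller side are too large. For the lower bound, a Paley
  graph of order 13 minus a vertex is doubled.\<close>

section \<open>Components of a color in a Gallai coloring\<close>

text \<open>Symmetry is demanded for all arguments, so that colors can be flipped without membership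
  side conditions.\<close>

definition gallai_on :: "'a set \<Rightarrow> ('a \<Rightarrow> 'a \<Rightarrow> 'b) \<Rightarrow> bool" where
  "gallai_on V c \<longleftrightarrow> (\<forall>x y. c x y = c y x) \<and>
     (\<forall>x\<in>V. \<forall>y\<in>V. \<forall>z\<in>V. x \<noteq> y \<longrightarrow> x \<noteq> z \<longrightarrow> y \<noteq> z \<longrightarrow>
        c x y = c x z \<or> c x y = c y z \<or> c x z = c y z)"

definition nb :: "'a set \<Rightarrow> ('a \<Rightarrow> 'a \<Rightarrow> 'b) \<Rightarrow> 'b \<Rightarrow> 'a \<Rightarrow> 'a set" where
  "nb V c a x = {y\<in>V. y \<noteq> x \<and> c x y = a}"

definition color_edges :: "'a set \<Rightarrow> ('a \<Rightarrow> 'a \<Rightarrow> 'b) \<Rightarrow> 'b \<Rightarrow> ('a \<times> 'a) set" where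
  "color_edges V c a = {(x, y). x \<in> V \<and> y \<in> V \<and> x \<noteq> y \<and> c x y = a}"

definition component :: "'a set \<Rightarrow> ('a \<Rightarrow> 'a \<Rightarrow> 'b) \<Rightarrow> 'b \<Rightarrow> 'a \<Rightarrow> 'a set" where
  "component V c a x = (color_edges V c a)\<^sup>* `` {x}"

definition mono_cut :: "'a set \<Rightarrow> ('a \<Rightarrow> 'a \<Rightarrow> 'b) \<Rightarrow> 'b \<Rightarrow> 'a set \<Rightarrow> bool" where
  "mono_cut V c a A \<longleftrightarrow> A \<subseteq> V \<and> A \<noteq> {} \<and> V - A \<noteq> {} \<and> (\<forall>x\<in>A. \<forall>y\<in>V - A. c x y = a)"

lemma gallai_on_sym: "gallai_on V c \<Longrightarrow> c x y = c y x"
  unfolding gallai_on_def by blast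

lemma gallai_on_triangle:
  assumes "gallai_on V c" "x \<in> V" "y \<in> V" "z \<in> V" "x \<noteq> y" "x \<noteq> z" "y \<noteq> z"
  shows "c x y = c x z \<or> c x y = c y z \<or> c x z = c y z"
  using assms unfolding gallai_on_def by blast

lemma gallai_on_subset: "gallai_on V c \<Longrightarrow> A \<subseteq> V \<Longrightarrow> gallai_on A c"
  unfolding gallai_on_def by (simp add: subset_iff)

lemma finite_nb [simp]: "finite V \<Longrightarrow> finite (nb V c a x)"
  unfolding nb_def by simp

lemma mem_component_self [simp]: "x \<in> component V c a x"
  unfolding component_def by auto

lemma component_trans: "y \<in> component V c a x \<Longrightarrow> z \<in> component V c a y \<Longrightarrow> z \<in> component V c a x"
  unfolding component_def by auto

lemma component_sym:
  assumes "gallai_on V c" "y \<in> component V c a x" shows "x \<in> component V c a y"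
proof -
  have "sym (color_edges V c a)"
    using gallai_on_sym[OF assms(1)] by (auto simp: sym_def color_edges_def)
  from symD[OF sym_rtrancl[OF this]] show ?thesis using assms(2) unfolding component_def by auto
qed

lemma component_eq:
  assumes "gallai_on V c" "y \<in> component V c a x"
  shows "component V c a y = component V c a x"
  using component_sym[OF assms] assms(2) component_trans[of _ V c a] by blast

lemma component_subset:
  assumes "x \<in> V" shows "component V c a x \<subseteq> V"
proof
  fix y assume "y \<in> component V c a x"
  then have "(x, y) \<in> (color_edges V c a)\<^sup>*" by (simp add: component_def)
  then show "y \<in> V" using assms by (induction) (auto simp: color_edges_def)
qed

lemma component_in_carrier: "y \<in> component V c a x \<Longrightarrow> x \<in> V \<Longrightarrow> y \<in> V"
  using component_subset by (rule subsetD)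

lemma component_disjoint:
  assumes "gallai_on V c" "y \<notin> component V c a x"
  shows "component V c a x \<inter> component V c a y = {}"
proof (rule ccontr)
  assume "component V c a x \<inter> component V c a y \<noteq> {}"
  then obtain z where "z \<in> component V c a x" "z \<in> component V c a y" by blast
  then show False using component_sym[OF assms(1)] component_trans assms(2) by metis
qed

lemma mem_componentI: "x \<in> V \<Longrightarrow> y \<in> V \<Longrightarrow> x \<noteq> y \<Longrightarrow> c x y = a \<Longrightarrow> y \<in> component V c a x"
  unfolding component_def color_edges_def by auto

lemma nb_subset_component: "x \<in> V \<Longrightarrow> nb V c a x \<subseteq> component V c a x - {x}"
  unfolding nb_def using mem_componentI by fastforce

lemma nb_in_component: "y \<in> nb V c a x \<Longrightarrow> x \<in> V \<Longrightarrow> y \<in> component V c a x"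
  using nb_subset_component by fast

text \<open>Along an \<open>a\<close>-edge \<open>u w\<close> of the component, neither
  \<open>u y\<close> nor \<open>w y\<close> has color \<open>a\<close>, so these two edges must
  agree for the triangle not to be rainbow. Induction along a path carries the color from
  \<open>x\<close> to \<open>x'\<close>.\<close>

lemma component_color_eq:
  assumes g: "gallai_on V c" and V: "x \<in> V" "y \<in> V" and y: "y \<notin> component V c a x"
    and x': "x' \<in> component V c a x"
  shows "c x' y = c x y"
proof -
  have "(x, x') \<in> (color_edges V c a)\<^sup>*" using x' by (simp add: component_def)
  then show ?thesis
  proof induction
    case base
    show ?case by simp
  next
    case (step u w)
    then have uw: "u \<in> V" "w \<in> V" "u \<noteq> w" "c u w = a" by (auto simp: color_edges_def)
    have mem: "u \<in> component V c a x" "w \<in> component V c a x"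
      using step by (auto simp: component_def intro: rtrancl_into_rtrancl)
    have ne: "u \<noteq> y" "w \<noteq> y" using mem y by auto
    have "c u y \<noteq> a" "c w y \<noteq> a"
      using mem_componentI[of _ V y c a] uw V(2) ne mem y component_trans by metis+
    then have "c w y = c u y"
      using gallai_on_triangle[OF g uw(1,2) V(2) uw(3) ne] uw(4) by auto
    then show ?case using step by simp
  qed
qed

text \<open>This lets later arguments work with one representative per component.\<close>

lemma component_color_eq2:
  assumes g: "gallai_on V c" and V: "x \<in> V" "y \<in> V" and y: "y \<notin> component V c a x"
    and x': "x' \<in> component V c a x" and y': "y' \<in> component V c a y"
  shows "c x' y' = c x y"
proof -
  have 1: "y' \<in> V" "y' \<notin> component V c a x"
    using component_in_carrier[OF y' V(2)] component_sym[OF g y'] component_trans y by metis+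
  have "x \<notin> component V c a y" using y component_sym[OF g] by blast
  then have "c y' x = c y x" by (rule component_color_eq[OF g V(2,1) _ y'])
  then show ?thesis
    using component_color_eq[OF g V(1) 1 x'] gallai_on_sym[OF g] by metis
qed

section \<open>Gallai's theorem: one of three colors is disconnected\<close>

text \<open>A path from \<open>z\<close> either stays in \<open>S\<close> or first enters
  \<open>v\<close> from a vertex \<open>w\<close> of the old component.\<close>

lemma component_insert_cases:
  assumes "z \<in> S" "t \<in> component (insert v S) c a z"
  shows "t \<in> component S c a z \<or> (\<exists>w\<in>S. w \<in> component S c a z \<and> c w v = a)"
proof -
  have "(z, t) \<in> (color_edges (insert v S) c a)\<^sup>*" using assms by (simp add: component_def)
  then show ?thesis
  proof induction
    case base
    show ?case by simp
  next
    case (step u w)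
    show ?case
    proof (cases "\<exists>w\<in>S. w \<in> component S c a z \<and> c w v = a")
      case False
      then have u: "u \<in> component S c a z" using step by blast
      then have "u \<in> S" using component_in_carrier assms(1) by metis
      then have "w \<in> S" "u \<noteq> w" "c u w = a" using False u step by (auto simp: color_edges_def)
      then show ?thesis using u \<open>u \<in> S\<close> component_trans mem_componentI by metis
    qed blast
  qed
qed

lemma component_color_neighbor:
  assumes "v \<in> V" "x \<in> component V c a v" "x \<noteq> v"
  obtains u where "u \<in> V" "u \<noteq> v" "c v u = a"
proof -
  have "(v, x) \<in> (color_edges V c a)\<^sup>*" using assms by (simp add: component_def)
  then show thesis
    by (cases rule: converse_rtranclE) (use assms(3) that in \<open>auto simp: color_edges_def\<close>)
qed

text \<open>Induction step: \<open>a\<close> splits \<open>S\<close>, and adding \<open>v\<close> is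
  supposed to connect all three colors. Then every \<open>a\<close>-component of \<open>S\<close>
  has an \<open>a\<close>-edge to \<open>v\<close>, while \<open>v\<close> also has edges of colors
  \<open>r\<close> and \<open>b\<close>. Triangles through \<open>v\<close> force both
  \<open>r\<close> and \<open>b\<close> between the same two components.\<close>

lemma gallai_disconnected_step:
  assumes g: "gallai_on (insert v S) c" and v: "v \<notin> S" and dist: "r \<noteq> b" "r \<noteq> a" "b \<noteq> a"
    and xy: "x \<in> S" "y \<in> S" "y \<notin> component S c a x"
    and conn: "\<And>k z w. k \<in> {r, b, a} \<Longrightarrow> z \<in> insert v S \<Longrightarrow> w \<in> insert v S
      \<Longrightarrow> w \<in> component (insert v S) c k z"
  shows False
proof -
  have gS: "gallai_on S c" using gallai_on_subset[OF g] by blast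
  \<comment> \<open>Some \<open>w\<close> in the component of \<open>z\<close> has
    \<open>c w v = a\<close>. Since \<open>c v u = k\<close> is not \<open>a\<close>, and
    \<open>c u w\<close> is not \<open>a\<close> across components, the triangle gives
    \<open>c u w = k\<close>, which then holds between the two components throughout.\<close>
  have forced: "c u z = k"
    if u: "u \<in> S" "c v u = k" and k: "k \<noteq> a" and z: "z \<in> S" "z \<notin> component S c a u" for u z k
  proof -
    have "v \<notin> component S c a z" using component_in_carrier z(1) v by metis
    then obtain w where w: "w \<in> S" "w \<in> component S c a z" "c w v = a"
      using component_insert_cases[OF z(1), of v v c a] conn[of a z v] z(1) by blast
    have wu: "w \<notin> component S c a u" using z(2) w(2) component_sym[OF gS] component_trans by metis
    then have "u \<noteq> w" "c u w \<noteq> a" using mem_componentI[OF u(1) w(1)] mem_component_self by metis+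
    moreover have "v \<noteq> u" "v \<noteq> w" using u(1) w(1) v by blast+
    ultimately have "c u w = k"
      using gallai_on_triangle[OF g, of v u w] u w k gallai_on_sym[OF g, of w v] by auto
    then show ?thesis using component_color_eq2[OF gS u(1) z mem_component_self w(2)] by simp
  qed
  have "\<exists>u\<in>S. c v u = k" if "k \<in> {r, b, a}" for k
  proof -
    have "x \<noteq> v" using xy v by auto
    then show ?thesis
      using component_color_neighbor[OF insertI1 conn[OF that, of v x]] xy(1) by blast
  qed
  then obtain u u' where u: "u \<in> S" "c v u = r" and u': "u' \<in> S" "c v u' = b" by blast
  obtain z where z: "z \<in> S" "z \<notin> component S c a u"
    using xy component_sym[OF gS] component_trans by metis
  show False
  proof (cases "u' \<in> component S c a u")
    case True
    then have "z \<notin> component S c a u'" using z component_trans by metis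
    then have "c u' z = b" "c u z = r" using forced u u' z dist by blast+
    then show False using component_color_eq[OF gS u(1) z True] dist by simp
  next
    case False
    then have "u \<notin> component S c a u'" using component_sym[OF gS] by blast
    then have "c u u' = r" "c u' u = b" using forced u u' False dist by blast+
    then show False using gallai_on_sym[OF g] dist by metis
  qed
qed

lemma gallai_disconnected:
  assumes "finite V" "gallai_on V c" "2 \<le> card V" "r \<noteq> b" "r \<noteq> a" "b \<noteq> a"
  shows "\<exists>k\<in>{r, b, a}. \<exists>x\<in>V. \<exists>y\<in>V. y \<notin> component V c k x"
  using assms(1-3)
proof induction
  case empty
  then show ?case by simp
next
  case (insert v S)
  show ?case
  proof (cases "2 \<le> card S")
    case True
    have "gallai_on S c" using gallai_on_subset insert.prems by blast
    then obtain k x y where k: "k \<in> {r, b, a}" and xy: "x \<in> S" "y \<in> S" "y \<notin> component S c k x"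
      using insert True by blast
    obtain k1 k2 where kk: "{r, b, a} = {k1, k2, k}" "k1 \<noteq> k2" "k1 \<noteq> k" "k2 \<noteq> k"
      using k assms(4-6) by (elim insertE emptyE) (force simp: insert_commute)+
    show ?thesis
      using gallai_disconnected_step[OF insert.prems(1) insert.hyps(2) kk(2-4) xy] kk(1) by metis
  next
    case False
    then have "card S = 1" using insert by simp
    then obtain s where S: "S = {s}" using card_1_singletonE by blast
    \<comment> \<open>Two vertices carry a single edge, so a color other than \<open>c v s\<close>
      has no edge at all.\<close>
    obtain k where k: "k \<in> {r, b, a}" "k \<noteq> c v s" using assms(4) by blast
    have "v \<noteq> s" using S insert by auto
    then have "s \<notin> component {v, s} c k v"
      using component_color_neighbor[of v "{v, s}" s c k] k(2) by blast
    then show ?thesis using k(1) S by blast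
  qed
qed

section \<open>Existence of a monochromatic cut\<close>

text \<open>For symmetric \<open>c\<close> and \<open>c x y\<close> other than \<open>i\<close>, the
  ends \<open>x\<close>, \<open>y\<close> lie outside the union, so an \<open>i\<close>-free book on
  \<open>x y\<close> has at most \<open>card V - 2 - m\<close> pages.\<close>

definition nb_union_ge :: "'a set \<Rightarrow> ('a \<Rightarrow> 'a \<Rightarrow> 'b) \<Rightarrow> 'b \<Rightarrow> nat \<Rightarrow> bool" where
  "nb_union_ge V c i m \<longleftrightarrow>
     (\<forall>x\<in>V. \<forall>y\<in>V. x \<noteq> y \<longrightarrow> c x y \<noteq> i \<longrightarrow> m \<le> card (nb V c i x \<union> nb V c i y))"

lemma nb_union_geD:
  "nb_union_ge V c i m \<Longrightarrow> x \<in> V \<Longrightarrow> y \<in> V \<Longrightarrow> x \<noteq> y \<Longrightarrow> c x y \<noteq> i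
    \<Longrightarrow> m \<le> card (nb V c i x \<union> nb V c i y)"
  unfolding nb_union_ge_def by blast

lemma degree_sum_ge:
  assumes "nb_union_ge V c i m" "x \<in> V" "y \<in> V" "x \<noteq> y" "c x y \<noteq> i"
  shows "m \<le> card (nb V c i x) + card (nb V c i y)"
  using nb_union_geD[OF assms] card_Un_le le_trans by blast

text \<open>The set difference holds the vertices that \<open>x\<close> reaches only by
  \<open>e\<close>-paths of length at least two. The additive form avoids truncated
  subtraction.\<close>

lemma card_component_diff_nb:
  assumes "finite V" "x \<in> V"
  shows "card (component V c e x - insert x (nb V c e x)) + card (nb V c e x) + 1
    = card (component V c e x)"
proof -
  have fin: "finite (component V c e x)"
    by (rule finite_subset[OF component_subset[OF assms(2)] assms(1)])
  have sub: "insert x (nb V c e x) \<subseteq> component V c e x"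
    using nb_subset_component[OF assms(2), of c e] mem_component_self[of x V c e] by auto
  have "card (insert x (nb V c e x)) = card (nb V c e x) + 1"
    using assms(1) by (subst card_insert_disjoint) (auto simp: nb_def)
  then show ?thesis
    using card_Diff_subset[OF finite_subset[OF sub fin] sub] card_mono[OF fin sub] by simp
qed

section \<open>Counting over four or five components\<close>

text \<open>Let \<open>C\<close>, \<open>D\<close> be the components of \<open>x\<close>,
  \<open>y\<close>. By \<open>star\<close>, color \<open>a\<close> leaves \<open>C\<close> only
  towards \<open>D\<close>, so the \<open>a\<close>-neighbors of \<open>x\<close> and
  \<open>x'\<close> lie in \<open>D\<close> or in \<open>C\<close> off the respective
  \<open>e\<close>-neighborhoods. As \<open>x x'\<close> has color \<open>e\<close>, there are at
  least \<open>m\<close> of them.\<close>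

lemma component_pair_count:
  assumes fin: "finite V" and g: "gallai_on V c" and x: "x \<in> V" and y: "y \<in> V"
    and x': "x' \<in> nb V c e x" and ae: "a \<noteq> e"
    and star: "\<And>z. z \<in> V \<Longrightarrow> z \<notin> component V c e x \<Longrightarrow> z \<notin> component V c e y \<Longrightarrow> c x z \<noteq> a"
    and m: "nb_union_ge V c a m"
  shows "m + card (nb V c e x) + card (nb V c e x') + 2
    \<le> 2 * card (component V c e x) + card (component V c e y)"
proof -
  let ?C = "component V c e x"
  let ?D = "component V c e y"
  have x'V: "x' \<in> V" "x' \<noteq> x" "c x x' = e" using x' by (auto simp: nb_def)
  have x'C: "x' \<in> ?C" using nb_in_component[OF x' x] .
  have eq: "component V c e x' = ?C" using component_eq[OF g x'C] .
  have sub: "nb V c a w \<subseteq> (component V c e w - insert w (nb V c e w)) \<union> ?D"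
    if w: "w \<in> ?C" for w
  proof
    fix z assume z: "z \<in> nb V c a w"
    then have z': "z \<in> V" "z \<noteq> w" "c w z = a" by (auto simp: nb_def)
    have ww: "component V c e w = ?C" using component_eq[OF g w] .
    have "z \<in> ?C \<or> z \<in> ?D"
      using component_color_eq[OF g x z'(1) _ w] star[OF z'(1)] z'(3) by metis
    then show "z \<in> (component V c e w - insert w (nb V c e w)) \<union> ?D"
      using z' ae ww by (auto simp: nb_def)
  qed
  let ?E = "component V c e x - insert x (nb V c e x)"
  let ?E' = "component V c e x' - insert x' (nb V c e x')"
  have finD: "finite ?D" "finite ?E" "finite ?E'"
    using component_subset[OF x, of c e] component_subset[OF y, of c e]
      component_subset[OF x'V(1), of c e] fin finite_subset by (metis finite_Diff)+
  have "nb V c a x \<union> nb V c a x' \<subseteq> ?E \<union> ?E' \<union> ?D"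
    using sub[of x] sub[of x'] x'C by auto
  then have "card (nb V c a x \<union> nb V c a x') \<le> card (?E \<union> ?E' \<union> ?D)"
    using finD by (intro card_mono) auto
  also have "\<dots> \<le> card ?E + card ?E' + card ?D"
    using card_Un_le[of "?E \<union> ?E'" ?D] card_Un_le[of ?E ?E'] by linarith
  finally have "m \<le> card ?E + card ?E' + card ?D"
    using nb_union_geD[OF m x x'V(1)] x'V ae by auto
  moreover have "card ?E + card (nb V c e x) + 1 = card ?C"
    using card_component_diff_nb[OF fin x] .
  moreover have "card ?E' + card (nb V c e x') + 1 = card ?C"
    using card_component_diff_nb[OF fin x'V(1), of c e] eq by simp
  ultimately show ?thesis by linarith
qed

text \<open>Distinct components are disjoint, and each contains its representative besides the
  \<open>e\<close>-neighbors of it; hence the \<open>+ 1\<close>.\<close>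

lemma sum_degrees_le:
  assumes fin: "finite V" and g: "gallai_on V c" and X: "X \<subseteq> V"
    and ind: "\<And>x y. x \<in> X \<Longrightarrow> y \<in> X \<Longrightarrow> x \<noteq> y \<Longrightarrow> y \<notin> component V c e x"
  shows "(\<Sum>x\<in>X. card (component V c e x)) \<le> card V"
    and "(\<Sum>x\<in>X. card (nb V c e x) + 1) \<le> card V"
proof -
  have sub: "component V c e x \<subseteq> V" if "x \<in> X" for x
    using component_subset[of x V c e] that X by blast
  have "card (\<Union>x\<in>X. component V c e x) = (\<Sum>x\<in>X. card (component V c e x))"
  proof (rule card_UN_disjoint)
    show "finite X" using X fin finite_subset by blast
    show "\<forall>x\<in>X. finite (component V c e x)" using sub fin finite_subset by blast
    show "\<forall>x\<in>X. \<forall>y\<in>X. x \<noteq> y \<longrightarrow> component V c e x \<inter> component V c e y = {}"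
      using component_disjoint[OF g ind] by blast
  qed
  moreover have "card (\<Union>x\<in>X. component V c e x) \<le> card V"
    using fin sub by (intro card_mono) auto
  ultimately show 1: "(\<Sum>x\<in>X. card (component V c e x)) \<le> card V" by simp
  have "card (nb V c e x) + 1 \<le> card (component V c e x)" if "x \<in> X" for x
    using card_component_diff_nb[OF fin, of x c e] that X by auto
  then have "(\<Sum>x\<in>X. card (nb V c e x) + 1) \<le> (\<Sum>x\<in>X. card (component V c e x))"
    by (rule sum_mono)
  then show "(\<Sum>x\<in>X. card (nb V c e x) + 1) \<le> card V" using 1 by simp
qed

lemma color_outside_component:
  "x \<in> V \<Longrightarrow> y \<in> V \<Longrightarrow> y \<notin> component V c e x \<Longrightarrow> x \<noteq> y \<and> c x y \<noteq> e"
  using mem_componentI mem_component_self by metis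

text \<open>Between the components \<open>a\<close> forms the path \<open>x1 x2 x3 x4\<close> and
  \<open>b\<close> the complementary path \<open>x3 x1 x4 x2\<close>. The end of a path sees that
  color in only one other component, so \<open>component_pair_count\<close> applies at all four. The
  sum of the four bounds is \<open>2 * ta + 2 * tb + 4 * te + 8 \<le> 3 * card V\<close>.\<close>

lemma four_components_path:
  assumes fin: "finite V" and g: "gallai_on V c"
    and V: "x1 \<in> V" "x2 \<in> V" "x3 \<in> V" "x4 \<in> V"
    and ind: "x2 \<notin> component V c e x1" "x3 \<notin> component V c e x1" "x4 \<notin> component V c e x1"
      "x3 \<notin> component V c e x2" "x4 \<notin> component V c e x2" "x4 \<notin> component V c e x3"
    and cover: "V \<subseteq> component V c e x1 \<union> component V c e x2 \<union> component V c e x3 \<union> component V c e x4"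
    and ab: "a \<noteq> b"
    and col: "c x1 x2 = a" "c x2 x3 = a" "c x3 x4 = a" "c x1 x3 = b" "c x1 x4 = b" "c x2 x4 = b"
    and t: "nb_union_ge V c a ta" "nb_union_ge V c b tb" "nb_union_ge V c e te"
    and large: "3 * te + 4 > card V" "3 * card V < 2 * (ta + tb + te) + 2 * te + 8"
  shows False
proof -
  let ?C = "component V c e" and ?d = "\<lambda>x. card (nb V c e x)"
  note sym = gallai_on_sym[OF g] and csym = component_sym[OF g]
  have ind': "x1 \<notin> ?C x2" "x1 \<notin> ?C x3" "x1 \<notin> ?C x4" "x2 \<notin> ?C x3" "x2 \<notin> ?C x4" "x3 \<notin> ?C x4"
    using ind csym by blast+
  have ne: "x1 \<noteq> x2" "x1 \<noteq> x3" "x1 \<noteq> x4" "x2 \<noteq> x3" "x2 \<noteq> x4" "x3 \<noteq> x4"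
    using ind by auto
  have abe: "a \<noteq> e" "b \<noteq> e"
    using color_outside_component[OF V(1,2) ind(1)] color_outside_component[OF V(1,3) ind(2)] col
    by auto
  have X: "{x1, x2, x3, x4} \<subseteq> V" using V by auto
  have indX: "y \<notin> ?C x" if "x \<in> {x1, x2, x3, x4}" "y \<in> {x1, x2, x3, x4}" "x \<noteq> y" for x y
    using that ind ind' by auto
  note sums = sum_degrees_le[OF fin g X indX]
  have v: "card (?C x1) + card (?C x2) + card (?C x3) + card (?C x4) \<le> card V"
    and d: "?d x1 + ?d x2 + ?d x3 + ?d x4 + 4 \<le> card V"
    using sums ne by auto
  have pair: "te \<le> ?d x + ?d y" if "x \<in> V" "y \<in> V" "y \<notin> ?C x" for x y
    using degree_sum_ge[OF t(3) that(1,2)] color_outside_component[OF that] by blast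
  note pairs = pair[OF V(1,2) ind(1)] pair[OF V(1,3) ind(2)] pair[OF V(1,4) ind(3)]
    pair[OF V(2,3) ind(4)] pair[OF V(2,4) ind(5)] pair[OF V(3,4) ind(6)]
  \<comment> \<open>If one degree were 0, the other three would be at least \<open>te\<close> each,
    giving \<open>3 * te + 4 \<le> card V\<close>. Each component thus has an \<open>e\<close>-edge
    for the pair count.\<close>
  have "?d x1 \<noteq> 0" "?d x2 \<noteq> 0" "?d x3 \<noteq> 0" "?d x4 \<noteq> 0"
    using pairs d large(1) by linarith+
  then obtain y1 y2 y3 y4 where y: "y1 \<in> nb V c e x1" "y2 \<in> nb V c e x2"
      "y3 \<in> nb V c e x3" "y4 \<in> nb V c e x4"
    using card.empty by (metis ex_in_conv)
  have mem: "y1 \<in> V" "y2 \<in> V" "y3 \<in> V" "y4 \<in> V" using y by (auto simp: nb_def)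
  have yC: "y1 \<in> ?C x1" "y2 \<in> ?C x2" "y3 \<in> ?C x3" "y4 \<in> ?C x4"
    using y nb_in_component V by metis+
  have pair': "te \<le> ?d x' + ?d y'"
    if "x \<in> V" "y \<in> V" "y \<notin> ?C x" "x' \<in> ?C x" "y' \<in> ?C y" for x y x' y'
  proof (rule pair)
    show "x' \<in> V" "y' \<in> V" using component_in_carrier that by metis+
    show "y' \<notin> ?C x'" using that(3-5) csym component_trans by metis
  qed
  have colC: "c x z = c x w" if "x \<in> V" "w \<in> V" "w \<notin> ?C x" "z \<in> ?C w" for x w z
    using component_color_eq2[OF g that(1-3) mem_component_self that(4)] .
  have n1: "ta + ?d x1 + ?d y1 + 2 \<le> 2 * card (?C x1) + card (?C x2)"
    using colC[OF V(1,3) ind(2)] colC[OF V(1,4) ind(3)] col ab cover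
    by (intro component_pair_count[OF fin g V(1,2) y(1) abe(1) _ t(1)]) auto
  have n4: "ta + ?d x4 + ?d y4 + 2 \<le> 2 * card (?C x4) + card (?C x3)"
    using colC[OF V(4,1) ind'(3)] colC[OF V(4,2) ind'(5)] col ab cover sym[of x4]
    by (intro component_pair_count[OF fin g V(4,3) y(4) abe(1) _ t(1)]) auto
  have n2: "tb + ?d x2 + ?d y2 + 2 \<le> 2 * card (?C x2) + card (?C x4)"
    using colC[OF V(2,1) ind'(1)] colC[OF V(2,3) ind(4)] col ab cover sym[of x2 x1]
    by (intro component_pair_count[OF fin g V(2,4) y(2) abe(2) _ t(2)]) auto
  have n3: "tb + ?d x3 + ?d y3 + 2 \<le> 2 * card (?C x3) + card (?C x1)"
    using colC[OF V(3,2) ind'(4)] colC[OF V(3,4) ind(6)] col ab cover sym[of x3 x2]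
    by (intro component_pair_count[OF fin g V(3,1) y(3) abe(2) _ t(2)]) auto
  have ny: "te \<le> ?d y1 + ?d y2" "te \<le> ?d y3 + ?d y4"
    using pair'[OF V(1,2) ind(1) yC(1,2)] pair'[OF V(3,4) ind(6) yC(3,4)] .
  have "2 * ta + 2 * tb + (?d x1 + ?d x2) + (?d x3 + ?d x4) + (?d y1 + ?d y2) + (?d y3 + ?d y4) + 8
      \<le> 3 * (card (?C x1) + card (?C x2) + card (?C x3) + card (?C x4))"
    using n1 n2 n3 n4 by simp
  also have "\<dots> \<le> 3 * card V" using v by simp
  finally show False using pairs(1,6) ny large(2) by simp
qed

text \<open>Adding degree pairs around the cycle \<open>x1 x2 x3 x4 x5\<close> gives
  \<open>5 * te \<le> 2 * D\<close> for the degree sum \<open>D\<close>, while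
  \<open>D + 5 \<le> card V\<close>.\<close>

lemma five_components:
  assumes fin: "finite V" and g: "gallai_on V c"
    and V: "x1 \<in> V" "x2 \<in> V" "x3 \<in> V" "x4 \<in> V" "x5 \<in> V"
    and ind: "x2 \<notin> component V c e x1" "x3 \<notin> component V c e x1" "x4 \<notin> component V c e x1"
      "x5 \<notin> component V c e x1" "x3 \<notin> component V c e x2" "x4 \<notin> component V c e x2"
      "x5 \<notin> component V c e x2" "x4 \<notin> component V c e x3" "x5 \<notin> component V c e x3"
      "x5 \<notin> component V c e x4"
    and t: "nb_union_ge V c e te"
    and large: "2 * card V < 5 * te + 10"
  shows False
proof -
  let ?C = "component V c e" and ?d = "\<lambda>x. card (nb V c e x)"
  have X: "{x1, x2, x3, x4, x5} \<subseteq> V" using V by auto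
  have ind': "x1 \<notin> ?C x2" "x1 \<notin> ?C x3" "x1 \<notin> ?C x4" "x1 \<notin> ?C x5" "x2 \<notin> ?C x3" "x2 \<notin> ?C x4"
    "x2 \<notin> ?C x5" "x3 \<notin> ?C x4" "x3 \<notin> ?C x5" "x4 \<notin> ?C x5"
    using ind component_sym[OF g] by blast+
  have indX: "y \<notin> ?C x"
    if "x \<in> {x1, x2, x3, x4, x5}" "y \<in> {x1, x2, x3, x4, x5}" "x \<noteq> y" for x y
    using that ind ind' by auto
  have ne: "x1 \<noteq> x2" "x1 \<noteq> x3" "x1 \<noteq> x4" "x1 \<noteq> x5" "x2 \<noteq> x3" "x2 \<noteq> x4" "x2 \<noteq> x5"
    "x3 \<noteq> x4" "x3 \<noteq> x5" "x4 \<noteq> x5"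
    using ind by auto
  have d: "?d x1 + ?d x2 + ?d x3 + ?d x4 + ?d x5 + 5 \<le> card V"
    using sum_degrees_le(2)[OF fin g X indX] ne by auto
  have pair: "te \<le> ?d x + ?d y" if "x \<in> V" "y \<in> V" "y \<notin> ?C x" for x y
    using degree_sum_ge[OF t that(1,2)] color_outside_component[OF that] by blast
  show False
    using pair[OF V(1,2) ind(1)] pair[OF V(2,3) ind(5)] pair[OF V(3,4) ind(8)]
      pair[OF V(4,5) ind(10)] pair[OF V(1,5) ind(4)] d large by linarith
qed

lemma mono_cut_component:
  assumes g: "gallai_on V c" and x: "x \<in> V" and y: "y \<in> V" "y \<notin> component V c e x"
    and a: "\<And>z. z \<in> V \<Longrightarrow> z \<notin> component V c e x \<Longrightarrow> c x z = a"
  shows "mono_cut V c a (component V c e x)"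
  unfolding mono_cut_def
proof (intro conjI ballI)
  show "component V c e x \<subseteq> V" using component_subset[OF x] .
  show "component V c e x \<noteq> {}" using mem_component_self by fast
  show "V - component V c e x \<noteq> {}" using y by blast
  fix u z assume "u \<in> component V c e x" "z \<in> V - component V c e x"
  then show "c u z = a" using a component_color_eq[OF g x, of z e u] by simp
qed

section \<open>From the counting to a monochromatic cut\<close>

text \<open>Without a cut, every component of a disconnected color \<open>e\<close> sees both other
  colors. This leads to exactly four components in the path pattern, which the count excludes.
  Thresholds depend on the color because deleting a vertex later lowers just one of them.\<close>

lemma mono_cut_exists:
  assumes fin: "finite V" and g: "gallai_on V c" and two: "2 \<le> card V"
    and K: "K = {p, q, r}" "p \<noteq> q" "p \<noteq> r" "q \<noteq> r"
    and cK: "\<And>x y. x \<in> V \<Longrightarrow> y \<in> V \<Longrightarrow> x \<noteq> y \<Longrightarrow> c x y \<in> K"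
    and t: "\<And>i. i \<in> K \<Longrightarrow> nb_union_ge V c i (t i)"
    and large: "\<And>i. i \<in> K \<Longrightarrow> 3 * t i + 4 > card V" "\<And>i. i \<in> K \<Longrightarrow> 2 * card V < 5 * t i + 10"
      "\<And>i. i \<in> K \<Longrightarrow> 3 * card V < 2 * sum t K + 2 * t i + 8"
  shows "\<exists>k\<in>K. \<exists>A. mono_cut V c k A"
proof (rule ccontr)
  assume nocut: "\<not> ?thesis"
  obtain e x1 y where e: "e \<in> K" and x1: "x1 \<in> V" and y: "y \<in> V" "y \<notin> component V c e x1"
    using gallai_disconnected[OF fin g two K(2,3,4)] K(1) by blast
  let ?C = "component V c e"
  note sym = gallai_on_sym[OF g] and csym = component_sym[OF g]
  \<comment> \<open>Otherwise the component of \<open>x\<close> would be one side of a cut of color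
    \<open>k\<close>.\<close>
  have other: "\<exists>z\<in>V. z \<notin> ?C x \<and> c x z \<noteq> k"
    if "x \<in> V" "w \<in> V" "w \<notin> ?C x" "k \<in> K" for x w k
    using mono_cut_component[OF g that(1-3), of k] nocut that(4) by blast
  have out: "x \<noteq> y \<and> c x y \<noteq> e \<and> c x y \<in> K" if "x \<in> V" "y \<in> V" "y \<notin> ?C x" for x y
    using color_outside_component[OF that] cK that by blast
  have path: False if p: "x1 \<in> V" "x2 \<in> V" "x3 \<in> V" "x4 \<in> V" "x2 \<notin> ?C x1" "x3 \<notin> ?C x1"
      "x4 \<notin> ?C x1" "x3 \<notin> ?C x2" "x4 \<notin> ?C x2" "x4 \<notin> ?C x3"
      "V \<subseteq> ?C x1 \<union> ?C x2 \<union> ?C x3 \<union> ?C x4" "a \<noteq> b"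
      "c x1 x2 = a" "c x2 x3 = a" "c x3 x4 = a" "c x1 x3 = b" "c x1 x4 = b" "c x2 x4 = b"
    for x1 x2 x3 x4 a b
  proof -
    have ab: "a \<in> K" "b \<in> K" "a \<noteq> e" "b \<noteq> e"
      using out[of x1 x2] out[of x1 x3] p by auto
    then have "K = {a, b, e}" using e K p(12) by auto
    then have "sum t K = t a + t b + t e" using ab(3,4) p(12) by auto
    then show False
      using four_components_path[OF fin g p t[OF ab(1)] t[OF ab(2)] t[OF e] large(1)[OF e]]
        large(3)[OF e] by auto
  qed
  obtain x3 where x3: "x3 \<in> V" "x3 \<notin> ?C x1" "c x1 x3 \<noteq> c x1 y"
    using other[OF x1 y] out[OF x1 y] by blast
  have "x3 \<notin> ?C y"
    using component_color_eq2[OF g x1 y mem_component_self] x3(3) by blast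
  have yx3: "c y x3 = c x1 y \<or> c y x3 = c x1 x3"
    using gallai_on_triangle[OF g x1 y(1) x3(1)] x3(3)
      out[OF x1 y] out[OF x1 x3(1,2)] out[OF y(1) x3(1) \<open>x3 \<notin> ?C y\<close>] by auto
  \<comment> \<open>Three components show exactly two colors; \<open>v\<close> is the one where the
    repeated color meets, here \<open>y\<close> or \<open>x3\<close>.\<close>
  have cent: "\<exists>u v w. u \<in> V \<and> v \<in> V \<and> w \<in> V \<and> v \<notin> ?C u \<and> w \<notin> ?C u \<and> w \<notin> ?C v \<and>
      c u v = c v w \<and> c u w \<noteq> c u v"
  proof (cases "c y x3 = c x1 y")
    case True
    then show ?thesis
      using x1 y x3 \<open>x3 \<notin> ?C y\<close> by metis
  next
    case False
    then have "c y x3 = c x1 x3" using yx3 by simp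
    moreover have "y \<notin> ?C x3" using csym \<open>x3 \<notin> ?C y\<close> by blast
    ultimately show ?thesis
      using x1 y x3 sym[of x3 y] by metis
  qed
  then obtain u v w where uvw: "u \<in> V" "v \<in> V" "w \<in> V" and
    ind: "v \<notin> ?C u" "w \<notin> ?C u" "w \<notin> ?C v" and col: "c u v = c v w" "c u w \<noteq> c u v" by blast
  define a b where ab: "a = c u v" "b = c u w"
  have abK: "a \<in> K" "b \<in> K" "a \<noteq> b" "a \<noteq> e" "b \<noteq> e"
    using out uvw ind col ab by auto
  then have Kab: "K = {a, b, e}" using e K by auto
  \<comment> \<open>The component of \<open>v\<close> must see \<open>b\<close> as well. It is
    joined to those of \<open>u\<close> and \<open>w\<close> in color \<open>a\<close>, so
    \<open>s\<close> lies in a fourth component.\<close>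
  obtain s where s: "s \<in> V" "s \<notin> ?C v" "c v s \<noteq> a" using other[OF uvw(2,3) ind(3) abK(1)] by blast
  have vs: "c v s = b" using out[OF uvw(2) s(1,2)] s(3) Kab by auto
  have vu: "u \<notin> ?C v" using ind(1) csym by blast
  have su: "s \<notin> ?C u"
    using component_color_eq2[OF g uvw(2,1) vu mem_component_self] s(3) ab(1) sym by metis
  have sw: "s \<notin> ?C w"
    using component_color_eq2[OF g uvw(2,3) ind(3) mem_component_self] s(3) ab(1) col(1) by metis
  have ind': "u \<notin> ?C v" "u \<notin> ?C w" "v \<notin> ?C w" "u \<notin> ?C s" "v \<notin> ?C s" "w \<notin> ?C s"
    using csym ind su s(2) sw by blast+
  have cover: "V \<subseteq> ?C u \<union> ?C v \<union> ?C w \<union> ?C s"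
  proof
    fix z assume z: "z \<in> V"
    show "z \<in> ?C u \<union> ?C v \<union> ?C w \<union> ?C s"
      using five_components[OF fin g uvw s(1) z ind(1,2) su _ ind(3) s(2) _ sw _ _ t[OF e]]
        large(2)[OF e] by blast
  qed
  have us: "c u s \<in> {a, b}" "c w s \<in> {a, b}"
    using out[OF uvw(1) s(1) su] out[OF uvw(3) s(1) sw] Kab by auto
  have col': "c v w = a" "c u v = a" "c u w = b" using ab col by auto
  \<comment> \<open>Two edges are undetermined. In the first two patterns \<open>a\<close> is a path
    through all four components; in the third it is a 4-cycle, so \<open>u\<close>, \<open>w\<close>
    against \<open>v\<close>, \<open>s\<close> is a cut; in the last, \<open>s\<close> sees only
    \<open>b\<close>.\<close>
  consider "c u s = b" "c w s = a" | "c u s = a" "c w s = b"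
    | "c u s = a" "c w s = a" | "c u s = b" "c w s = b" using us by auto
  then show False
  proof cases
    case 1
    then show False
      using path[OF uvw s(1) ind(1,2) su ind(3) s(2) sw cover abK(3)] col' vs by auto
  next
    case 2
    have cov: "V \<subseteq> ?C s \<union> ?C u \<union> ?C v \<union> ?C w" using cover by auto
    show False
      using path[OF s(1) uvw ind'(4-6) ind cov abK(3)] 2 col' vs sym[of s] by auto
  next
    case 3
    have "mono_cut V c a (?C u \<union> ?C w)"
      unfolding mono_cut_def
    proof (intro conjI ballI)
      show "?C u \<union> ?C w \<subseteq> V" "?C u \<union> ?C w \<noteq> {}"
        using component_subset[OF uvw(1), of c e] component_subset[OF uvw(3), of c e]
          mem_component_self[of u V c e] by blast+
      show "V - (?C u \<union> ?C w) \<noteq> {}" using uvw ind' ind by auto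
      fix x z assume xz: "x \<in> ?C u \<union> ?C w" "z \<in> V - (?C u \<union> ?C w)"
      then have z: "z \<in> ?C v \<or> z \<in> ?C s" using cover by auto
      note eq2 = component_color_eq2[OF g]
      show "c x z = a"
        using xz(1) z eq2[OF uvw(1,2) ind(1)] eq2[OF uvw(1) s(1) su] eq2[OF uvw(3,2) ind'(3)]
          eq2[OF uvw(3) s(1) sw] 3 col' sym[of w v] by auto
    qed
    then show False using nocut abK(1) by blast
  next
    case 4
    have "c s z = b" if z: "z \<in> V" "z \<notin> ?C s" for z
    proof -
      note eq2 = component_color_eq2[OF g s(1) _ _ mem_component_self]
      have "z \<in> ?C u \<or> z \<in> ?C v \<or> z \<in> ?C w" using cover z by auto
      then show ?thesis
        using eq2[OF uvw(1) ind'(4)] eq2[OF uvw(2) ind'(5)] eq2[OF uvw(3) ind'(6)] 4 vs sym[of s]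
        by auto
    qed
    then show False using other[OF s(1) uvw(1) ind'(4) abK(2)] by blast
  qed
qed

section \<open>Two colors on at most twelve vertices\<close>

text \<open>Integer sums of indicators let the double counting below exchange sums and
  subtract.\<close>

lemma card_nb_sum:
  assumes "finite A"
  shows "int (card (nb A c i x)) = (\<Sum>y\<in>A. of_bool (y \<noteq> x \<and> c x y = i))"
  using assms by (simp add: nb_def sum.If_cases Int_def of_bool_def)

lemma card_nb_Un_sum:
  assumes "finite A"
  shows "int (card (nb A c i x \<union> nb A c i y)) =
    (\<Sum>z\<in>A. of_bool (z \<noteq> x \<and> c x z = i) + of_bool (z \<noteq> y \<and> c y z = i)
      - of_bool (z \<noteq> x \<and> c x z = i) * of_bool (z \<noteq> y \<and> c y z = i))"
proof -
  have "nb A c i x \<union> nb A c i y = {z \<in> A. (z \<noteq> x \<and> c x z = i) \<or> (z \<noteq> y \<and> c y z = i)}"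
    by (auto simp: nb_def)
  then have "int (card (nb A c i x \<union> nb A c i y)) =
    (\<Sum>z\<in>A. of_bool ((z \<noteq> x \<and> c x z = i) \<or> (z \<noteq> y \<and> c y z = i)))"
    using assms by (simp add: sum.If_cases Int_def of_bool_def)
  also have "\<dots> = (\<Sum>z\<in>A. of_bool (z \<noteq> x \<and> c x z = i) + of_bool (z \<noteq> y \<and> c y z = i)
      - of_bool (z \<noteq> x \<and> c x z = i) * of_bool (z \<noteq> y \<and> c y z = i))"
    by (intro sum.cong) auto
  finally show ?thesis .
qed

text \<open>Both sides count triples. A triangle with exactly the colors \<open>i\<close>, \<open>j\<close> has two vertices where
  both colors meet, while each of its three edges sees the other color, in two orientations.\<close>

lemma bichromatic_count:
  assumes fin: "finite A" and g: "gallai_on A c" and ij: "i \<noteq> j"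
    and i: "nb_union_ge A c i m" and j: "nb_union_ge A c j m"
  shows "int m * (\<Sum>x\<in>A. int (card (nb A c i x)) + int (card (nb A c j x)))
    \<le> 3 * (\<Sum>x\<in>A. int (card (nb A c i x)) * int (card (nb A c j x)))"
proof -
  define B G where BG: "B = (\<lambda>x y. of_bool (y \<noteq> x \<and> c x y = i) :: int)"
    "G = (\<lambda>x y. of_bool (y \<noteq> x \<and> c x y = j) :: int)"
  have sym: "B x y = B y x" "G x y = G y x" for x y
    using gallai_on_sym[OF g, of x y] by (auto simp: BG)
  \<comment> \<open>\<open>P\<close> counts an \<open>i\<close>-edge and a \<open>j\<close>-edge
    meeting at \<open>x\<close>, \<open>Q\<close> an \<open>i\<close>-edge with a vertex joined to
    both ends in color \<open>j\<close>, and \<open>R\<close> is \<open>Q\<close> with the colors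
    exchanged.\<close>
  define P Q R where PQR: "P = (\<Sum>x\<in>A. \<Sum>y\<in>A. \<Sum>z\<in>A. B x y * G x z)"
    "Q = (\<Sum>x\<in>A. \<Sum>y\<in>A. \<Sum>z\<in>A. B x y * (G x z * G y z))"
    "R = (\<Sum>x\<in>A. \<Sum>y\<in>A. \<Sum>z\<in>A. G x y * (B x z * B y z))"
  have P1: "(\<Sum>x\<in>A. \<Sum>y\<in>A. \<Sum>z\<in>A. B x y * G y z) = P"
    unfolding PQR by (subst sum.swap) (simp add: sym)
  have P2: "(\<Sum>x\<in>A. \<Sum>y\<in>A. \<Sum>z\<in>A. G x y * B x z) = P"
    unfolding PQR by (rule sum.cong[OF refl], subst sum.swap) (simp add: mult.commute)
  have P3: "(\<Sum>x\<in>A. \<Sum>y\<in>A. \<Sum>z\<in>A. G x y * B y z) = P"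
    unfolding P2[symmetric] by (subst sum.swap) (simp add: sym)
  have R2: "R = (\<Sum>x\<in>A. \<Sum>y\<in>A. \<Sum>z\<in>A. B x y * G x z * B y z)"
    unfolding PQR by (rule sum.cong[OF refl], subst sum.swap) (simp add: mult_ac sym)
  \<comment> \<open>The third side \<open>y z\<close> has color \<open>i\<close> or
    \<open>j\<close>: color \<open>j\<close> is counted by \<open>Q\<close>, color \<open>i\<close>
    by \<open>R\<close>.\<close>
  have split: "B x y * G x z = B x y * (G x z * G y z) + B x y * G x z * B y z"
    if "x \<in> A" "y \<in> A" "z \<in> A" for x y z
  proof (cases "y \<noteq> x \<and> c x y = i \<and> z \<noteq> x \<and> c x z = j")
    case True
    then have "y \<noteq> z" using ij by auto
    then have "c y z = i \<or> c y z = j"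
      using gallai_on_triangle[OF g that] True ij by auto
    then show ?thesis using ij True \<open>y \<noteq> z\<close> by (auto simp: BG)
  qed (auto simp: BG)
  have PQR_eq: "P = Q + R"
    unfolding PQR(1,2) R2 sum.distrib[symmetric] using split by (intro sum.cong refl) auto
  have deg: "(\<Sum>y\<in>A. B x y) = int (card (nb A c i x))"
      "(\<Sum>y\<in>A. G x y) = int (card (nb A c j x))" for x
    by (simp_all add: card_nb_sum[OF fin] BG)
  \<comment> \<open>Inclusion-exclusion for the \<open>j\<close>-neighborhoods at an
    \<open>i\<close>-edge sums to \<open>2 * P - Q\<close>; the twin bound is
    \<open>2 * P - R\<close>. Together they give \<open>4 * P - (Q + R) = 3 * P\<close>.\<close>
  have "int m * B x y \<le> (\<Sum>z\<in>A. B x y * G x z + B x y * G y z - B x y * (G x z * G y z))"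
    if "x \<in> A" "y \<in> A" for x y
  proof (cases "y \<noteq> x \<and> c x y = i")
    case True
    then have "int m \<le> int (card (nb A c j x \<union> nb A c j y))"
      using nb_union_geD[OF j that] ij by auto
    then show ?thesis using True by (simp add: card_nb_Un_sum[OF fin] BG)
  qed (auto simp: BG)
  then have "(\<Sum>x\<in>A. \<Sum>y\<in>A. int m * B x y)
      \<le> (\<Sum>x\<in>A. \<Sum>y\<in>A. \<Sum>z\<in>A. B x y * G x z + B x y * G y z - B x y * (G x z * G y z))"
    by (intro sum_mono) auto
  then have b: "int m * (\<Sum>x\<in>A. int (card (nb A c i x))) \<le> 2 * P - Q"
    using P1 by (simp add: sum.distrib sum_subtractf PQR sum_distrib_left[symmetric] deg)
  have "int m * G x y \<le> (\<Sum>z\<in>A. G x y * B x z + G x y * B y z - G x y * (B x z * B y z))"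
    if "x \<in> A" "y \<in> A" for x y
  proof (cases "y \<noteq> x \<and> c x y = j")
    case True
    then have "int m \<le> int (card (nb A c i x \<union> nb A c i y))"
      using nb_union_geD[OF i that] ij by auto
    then show ?thesis using True by (simp add: card_nb_Un_sum[OF fin] BG)
  qed (auto simp: BG)
  then have "(\<Sum>x\<in>A. \<Sum>y\<in>A. int m * G x y)
      \<le> (\<Sum>x\<in>A. \<Sum>y\<in>A. \<Sum>z\<in>A. G x y * B x z + G x y * B y z - G x y * (B x z * B y z))"
    by (intro sum_mono) auto
  then have "(\<Sum>x\<in>A. \<Sum>y\<in>A. int m * G x y)
      \<le> (\<Sum>x\<in>A. \<Sum>y\<in>A. \<Sum>z\<in>A. G x y * B x z)
        + (\<Sum>x\<in>A. \<Sum>y\<in>A. \<Sum>z\<in>A. G x y * B y z) - R"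
    by (simp only: sum.distrib sum_subtractf PQR(3))
  then have r: "int m * (\<Sum>x\<in>A. int (card (nb A c j x))) \<le> 2 * P - R"
    unfolding P2 P3 by (simp add: sum_distrib_left[symmetric] deg)
  have "P = (\<Sum>x\<in>A. (\<Sum>y\<in>A. B x y) * (\<Sum>z\<in>A. G x z))"
    unfolding PQR(1) by (simp add: sum_product)
  then show ?thesis
    using b r PQR_eq by (simp add: deg sum.distrib distrib_left)
qed

lemma card_two_nb_le:
  assumes "finite A" "x \<in> A" "i \<noteq> j"
  shows "card (nb A c i x) + card (nb A c j x) + 1 \<le> card A"
proof -
  have "nb A c i x \<inter> nb A c j x = {}" using assms(3) by (auto simp: nb_def)
  then have "card (nb A c i x) + card (nb A c j x) = card (nb A c i x \<union> nb A c j x)"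
    using assms(1) by (simp add: card_Un_disjoint)
  also have "\<dots> \<le> card (A - {x})" using assms(1) by (intro card_mono) (auto simp: nb_def)
  finally show ?thesis
    using assms(1,2) card_Suc_Diff1[of A x] by simp
qed

text \<open>By the arithmetic-geometric mean, \<open>a * b\<close> is at most
  \<open>11/4 * (a + b)\<close>, below \<open>3 * (a + b)\<close> unless both are 0. A sum of 12
  would allow equality at \<open>a = b = 6\<close>. Fixing \<open>a\<close> makes the claim linear
  in \<open>b\<close>.\<close>

lemma product_le_three_sum:
  fixes a b :: nat
  assumes "a + b \<le> 11"
  shows "a * b \<le> 3 * (a + b)" "a * b = 3 * (a + b) \<Longrightarrow> a = 0 \<and> b = 0"
proof -
  have "a = 0 \<or> a = 1 \<or> a = 2 \<or> a = 3 \<or> a = 4 \<or> a = 5 \<or> a = 6 \<or> a = 7 \<or> a = 8 \<or> a = 9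
      \<or> a = 10 \<or> a = 11" using assms by presburger
  then have *: "a * b \<le> 3 * (a + b) \<and> (a * b = 3 * (a + b) \<longrightarrow> a = 0 \<and> b = 0)"
    using assms by (elim disjE) auto
  then show "a * b \<le> 3 * (a + b)" "a * b = 3 * (a + b) \<Longrightarrow> a = 0 \<and> b = 0" by auto
qed

text \<open>With \<open>m = 9\<close> the triple count says that three times the sum of both degrees
  is at most the sum of their products. On 12 vertices the two degrees add up to at most 11, so the
  reverse holds termwise, strictly unless both vanish.\<close>

lemma small_side_avoids_two_colors:
  assumes fin: "finite A" and g: "gallai_on A c" and card: "card A \<le> 12" and ij: "i \<noteq> j"
    and i: "nb_union_ge A c i 9" and j: "nb_union_ge A c j 9" and x: "x \<in> A"
  shows "nb A c i x = {}" "nb A c j x = {}"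
proof -
  \<comment> \<open>By \<open>le\<close> below, the truncated subtraction is exact on
    \<open>A\<close>.\<close>
  define f where "f = (\<lambda>x. 3 * (card (nb A c i x) + card (nb A c j x))
    - card (nb A c i x) * card (nb A c j x))"
  have le: "card (nb A c i x) * card (nb A c j x) \<le> 3 * (card (nb A c i x) + card (nb A c j x))"
    and z: "f x = 0 \<Longrightarrow> card (nb A c i x) = 0 \<and> card (nb A c j x) = 0"
    if "x \<in> A" for x
    using product_le_three_sum[of "card (nb A c i x)" "card (nb A c j x)"]
      card_two_nb_le[OF fin that ij, of c] card unfolding f_def by auto
  have "int (\<Sum>x\<in>A. f x) = (\<Sum>x\<in>A. 3 * (int (card (nb A c i x)) + int (card (nb A c j x)))
      - int (card (nb A c i x)) * int (card (nb A c j x)))"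
    unfolding of_nat_sum f_def using le by (intro sum.cong refl) (simp add: of_nat_diff)
  also have "\<dots> \<le> 0"
    using bichromatic_count[OF fin g ij i j]
    by (simp add: sum_subtractf sum.distrib sum_distrib_left[symmetric] distrib_left)
  finally have "(\<Sum>x\<in>A. f x) = 0" by (simp only: of_nat_le_0_iff)
  then have "f x = 0" using fin x by simp
  then have "card (nb A c i x) = 0 \<and> card (nb A c j x) = 0" using z[OF x] by blast
  then show "nb A c i x = {}" "nb A c j x = {}" using fin by simp_all
qed

section \<open>The upper bound\<close>

lemma mono_cut_small_side:
  assumes fin: "finite V" and g: "gallai_on V c" and cut: "mono_cut V c k A"
  obtains B where "mono_cut V c k B" "2 * card B \<le> card V"
proof (cases "2 * card A \<le> card V")
  case False
  have sub: "A \<subseteq> V" and cut': "A \<noteq> {}" "V - A \<noteq> {}" "\<And>x y. x \<in> A \<Longrightarrow> y \<in> V - A \<Longrightarrow> c x y = k"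
    using cut unfolding mono_cut_def by auto
  have "V - (V - A) = A" using sub by blast
  then have "mono_cut V c k (V - A)"
    unfolding mono_cut_def
  proof (intro conjI ballI)
    show "V - A \<noteq> {}" by (rule cut'(2))
    show "V - (V - A) \<noteq> {}" using cut'(1) \<open>V - (V - A) = A\<close> by simp
    fix x y assume "x \<in> V - A" "y \<in> V - (V - A)"
    then show "c x y = k" using cut'(3)[of y x] gallai_on_sym[OF g, of x y] by auto
  qed blast
  moreover have "2 * card (V - A) \<le> card V"
    using False sub fin by (simp add: card_Diff_subset finite_subset)
  ultimately show thesis by (rule that)
qed (use cut that in blast)

text \<open>Only color \<open>k\<close> crosses the cut.\<close>

lemma mono_cut_nb:
  assumes "mono_cut V c k A" "x \<in> A" "i \<noteq> k"
  shows "nb V c i x = nb A c i x"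
  using assms unfolding mono_cut_def nb_def by blast

lemma mono_cut_nb_union_ge:
  assumes cut: "mono_cut V c k A" and i: "i \<noteq> k" "nb_union_ge V c i m"
  shows "nb_union_ge A c i m"
  unfolding nb_union_ge_def
proof (intro ballI impI)
  fix x y assume xy: "x \<in> A" "y \<in> A" "x \<noteq> y" "c x y \<noteq> i"
  then have "x \<in> V" "y \<in> V" using cut unfolding mono_cut_def by auto
  then show "m \<le> card (nb A c i x \<union> nb A c i y)"
    using nb_union_geD[OF i(2) _ _ xy(3,4)] mono_cut_nb[OF cut xy(1) i(1)]
      mono_cut_nb[OF cut xy(2) i(1)] by simp
qed

lemma no_gallai_nb_union_ge_25:
  assumes fin: "finite V" and g: "gallai_on V c" and card: "card V = 25"
    and K: "K = {p, q, r}" "p \<noteq> q" "p \<noteq> r" "q \<noteq> r"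
    and cK: "\<And>x y. x \<in> V \<Longrightarrow> y \<in> V \<Longrightarrow> x \<noteq> y \<Longrightarrow> c x y \<in> K"
    and nine: "\<And>i. i \<in> K \<Longrightarrow> nb_union_ge V c i 9"
  shows False
proof -
  have "card K = 3" using K by simp
  \<comment> \<open>With all thresholds 9 the conditions are 25 < 31, 50 < 55 and 75 < 80.\<close>
  then have "\<exists>k\<in>K. \<exists>A. mono_cut V c k A"
    by (intro mono_cut_exists[OF fin g _ K cK nine]) (simp_all add: card)
  then obtain k A where k: "k \<in> K" and A: "mono_cut V c k A" "2 * card A \<le> card V"
    using mono_cut_small_side[OF fin g] by metis
  obtain i j where ij: "K = {k, i, j}" "i \<noteq> j" "i \<noteq> k" "j \<noteq> k"
  proof -
    consider "k = p" | "k = q" | "k = r" using k K by blast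
    then show thesis
    proof cases
      case 1
      then show thesis using that[of q r] K by auto
    next
      case 2
      then show thesis using that[of p r] K by (auto simp: insert_commute)
    next
      case 3
      then show thesis using that[of p q] K by (auto simp: insert_commute)
    qed
  qed
  then have iK: "i \<in> K" and jK: "j \<in> K" by auto
  have AV: "A \<subseteq> V" and "A \<noteq> {}" and cross: "\<And>x y. x \<in> A \<Longrightarrow> y \<in> V - A \<Longrightarrow> c x y = k"
    using A(1) unfolding mono_cut_def by auto
  have cA: "card A \<le> 12" using A(2) card by simp
  have finA: "finite A" using AV fin finite_subset by blast
  have gA: "gallai_on A c" using gallai_on_subset[OF g AV] .
  note empty = small_side_avoids_two_colors[OF finA gA cA ij(2)
      mono_cut_nb_union_ge[OF A(1) ij(3) nine[OF iK]] mono_cut_nb_union_ge[OF A(1) ij(4) nine[OF jK]]]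
  have noA: "nb V c i x = {}" "nb V c j x = {}" if "x \<in> A" for x
    using empty[OF that] mono_cut_nb[OF A(1) that] ij by simp_all
  obtain x where x: "x \<in> A" using \<open>A \<noteq> {}\<close> by blast
  \<comment> \<open>A second vertex \<open>y\<close> would give an edge \<open>x y\<close> of color
    other than \<open>i\<close> whose ends have no \<open>i\<close>-neighbors at all.\<close>
  have single: "A = {x}"
  proof (rule ccontr)
    assume "A \<noteq> {x}"
    then obtain y where y: "y \<in> A" "y \<noteq> x" using x by blast
    then have "c x y \<noteq> i" using noA(1)[OF x] AV by (auto simp: nb_def)
    then show False
      using nb_union_geD[OF nine[OF iK], of x y] noA(1) x y AV by auto
  qed
  define B where "B = V - {x}"
  have xV: "x \<in> V" using x AV by blast
  have BV: "B \<subseteq> V" and finB: "finite B" and cB: "card B = 24"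
    using xV card fin by (auto simp: B_def)
  have xB: "c x y = k" "c y x = k" if "y \<in> B" for y
    using cross[OF x, of y] that single gallai_on_sym[OF g, of y x] by (auto simp: B_def)
  have nbB: "nb B c l y = nb V c l y" if "y \<in> B" "l \<noteq> k" for y l
    using that xB by (auto simp: nb_def B_def)
  \<comment> \<open>The edge \<open>x y\<close> has color \<open>k\<close> and \<open>x\<close> has
    no \<open>l\<close>-neighbors, so \<open>y\<close> alone supplies all nine.\<close>
  have deg: "9 \<le> card (nb B c l y)" if y: "y \<in> B" and l: "l \<in> {i, j}" for y l
  proof -
    have yV: "y \<in> V" "x \<noteq> y" using y by (auto simp: B_def)
    have lK: "l \<in> K" "l \<noteq> k" "nb V c l x = {}" using l ij noA x by auto
    have "9 \<le> card (nb V c l x \<union> nb V c l y)"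
      using nb_union_geD[OF nine[OF lK(1)] xV yV] xB y lK by auto
    then show ?thesis using lK(3) nbB[OF y lK(2)] by simp
  qed
  have gB: "gallai_on B c" using gallai_on_subset[OF g BV] .
  \<comment> \<open>As \<open>x\<close> is joined to \<open>B\<close> entirely in color
    \<open>k\<close>, its deletion costs one \<open>k\<close>-neighbor and nothing in the other
    colors.\<close>
  define t where "t = (\<lambda>l. if l = k then 8 else 9 :: nat)"
  have thr: "nb_union_ge B c l (t l)" if l: "l \<in> K" for l
    unfolding nb_union_ge_def
  proof (intro ballI impI)
    fix y z assume yz: "y \<in> B" "z \<in> B" "y \<noteq> z" "c y z \<noteq> l"
    have 9: "9 \<le> card (nb V c l y \<union> nb V c l z)"
      using nb_union_geD[OF nine[OF l] _ _ yz(3,4)] yz(1,2) BV by blast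
    show "t l \<le> card (nb B c l y \<union> nb B c l z)"
    proof (cases "l = k")
      case True
      have "nb V c l y \<union> nb V c l z \<subseteq> insert x (nb B c l y \<union> nb B c l z)"
        by (auto simp: nb_def B_def)
      then have "card (nb V c l y \<union> nb V c l z) \<le> card (insert x (nb B c l y \<union> nb B c l z))"
        using finB by (intro card_mono) auto
      also have "\<dots> \<le> Suc (card (nb B c l y \<union> nb B c l z))" by (rule card_insert_le_m1) auto
      finally show ?thesis using 9 True by (simp add: t_def)
    next
      case False
      then show ?thesis using 9 nbB yz(1,2) by (simp add: t_def)
    qed
  qed
  \<comment> \<open>Even at threshold 8 the conditions hold: 24 < 28, 48 < 50 and 72 < 76.\<close>
  have "sum t K = 26" unfolding ij(1) using ij(2-4) by (simp add: t_def)
  then have "\<exists>l\<in>K. \<exists>C. mono_cut B c l C"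
    by (intro mono_cut_exists[OF finB gB _ K _ thr]) (use cK BV in \<open>auto simp: cB t_def\<close>)
  then obtain l C where l: "l \<in> K" and C: "mono_cut B c l C" "2 * card C \<le> card B"
    using mono_cut_small_side[OF finB gB] by metis
  have CB: "C \<subseteq> B" and "C \<noteq> {}"
    using C(1) unfolding mono_cut_def by auto
  have finC: "finite C" using CB finB finite_subset by blast
  have cC: "card C \<le> 12" using C(2) cB by simp
  obtain y where y: "y \<in> C" using \<open>C \<noteq> {}\<close> by blast
  have yB: "y \<in> B" using y CB by blast
  show False
  proof (cases "l = k")
    case True
    \<comment> \<open>Nine neighbors in each of two colors do not fit into 12 vertices.\<close>
    have "9 \<le> card (nb C c i y)" "9 \<le> card (nb C c j y)"
      using deg[OF yB, of i] deg[OF yB, of j] mono_cut_nb[OF C(1) y] True ij(3,4) by simp_all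
    then show False using card_two_nb_le[OF finC y ij(2), of c] cC by linarith
  next
    case False
    then obtain h where h: "h \<in> {i, j}" "h \<noteq> l" "h \<noteq> k" using ij by blast
    \<comment> \<open>Color \<open>h\<close> does not cross the cut, so nine of at most 11 other
      vertices of \<open>C\<close> are \<open>h\<close>-neighbors of \<open>z\<close>.\<close>
    have degk: "card (nb C c k z) \<le> 2" if z: "z \<in> C" for z
    proof -
      have "9 \<le> card (nb C c h z)"
        using deg[of z h] z CB h mono_cut_nb[OF C(1) z h(2)] by auto
      then show ?thesis using card_two_nb_le[OF finC z h(3), of c] cC by linarith
    qed
    have "nb C c h y \<noteq> {}"
      using deg[OF yB h(1)] mono_cut_nb[OF C(1) y h(2)] by auto
    then obtain z where z: "z \<in> C" "z \<noteq> y" "c y z = h" by (auto simp: nb_def)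
    \<comment> \<open>The ends of an \<open>h\<close>-edge in \<open>C\<close> need 8
      \<open>k\<close>-neighbors together, all in \<open>C\<close>, but have at most 2 each.\<close>
    have "8 \<le> card (nb B c k y \<union> nb B c k z)"
      using nb_union_geD[OF thr[OF k], of y z] z y CB h(3) by (auto simp: t_def)
    also have "\<dots> = card (nb C c k y \<union> nb C c k z)"
      using mono_cut_nb[OF C(1)] y z(1) False by metis
    also have "\<dots> \<le> card (nb C c k y) + card (nb C c k z)" by (rule card_Un_le)
    finally show False using degk[OF y] degk[OF z(1)] by linarith
  qed
qed

section \<open>Books\<close>

definition pages :: "nat \<Rightarrow> (nat set \<Rightarrow> nat) \<Rightarrow> nat \<Rightarrow> nat \<Rightarrow> nat \<Rightarrow> nat set" where
  "pages p f i x y = {z. z < p \<and> z \<noteq> x \<and> z \<noteq> y \<and> f {x, z} \<noteq> i \<and> f {y, z} \<noteq> i}"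

lemma finite_pages [simp]: "finite (pages p f i x y)"
  unfolding pages_def by simp

lemma verts_book: "verts (book n) = {Inl 0, Inl 1} \<union> Inr ` {..<n}"
  unfolding book_def graph_join_def complete_graph_def empty_graph_def
  by (auto simp: lessThan_Suc numeral_2_eq_2)

lemma edges_book:
  "edges (book n) = insert {Inl 0, Inl 1} ((\<lambda>k. {Inl 0, Inr k}) ` {..<n} \<union> (\<lambda>k. {Inl 1, Inr k}) ` {..<n})"
proof -
  have two: "u < (2::nat) \<longleftrightarrow> u = 0 \<or> u = 1" for u by auto
  have e: "edges (complete_graph 2) = {{0, 1}}"
    unfolding complete_graph_def two by auto
  have v: "verts (complete_graph 2) = {0, 1}" "verts (empty_graph n) = {..<n}"
    "edges (empty_graph n) = {}"
    unfolding complete_graph_def empty_graph_def by (auto simp: two)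
  have "{{Inl u, Inr w} | u w. u \<in> {0::nat, 1} \<and> w \<in> {..<n}}
    = (\<lambda>k. {Inl 0, Inr k}) ` {..<n} \<union> (\<lambda>k. {Inl 1, Inr k}) ` {..<n}"
    by blast
  then show ?thesis
    unfolding book_def graph_join_def snd_conv e v by simp
qed

lemma edges_complete_graph_iff:
  "{u, v} \<in> edges (complete_graph p) \<longleftrightarrow> u < p \<and> v < p \<and> u \<noteq> v"
  unfolding complete_graph_def by (auto simp: doubleton_eq_iff)

lemma coloring_range:
  "coloring t p f \<Longrightarrow> x < p \<Longrightarrow> y < p \<Longrightarrow> x \<noteq> y \<Longrightarrow> f {x, y} \<in> {1..t}"
  unfolding coloring_def using edges_complete_graph_iff by blast

text \<open>A copy with at most two colors misses one of the three, and the images of its pages are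
  pages for that color.\<close>

lemma contains_bookD:
  assumes "contains_colored_copy 2 p f (book n)"
  obtains x y i where "x < p" "y < p" "x \<noteq> y" "i \<in> {1..3}" "f {x, y} \<noteq> i" "n \<le> card (pages p f i x y)"
proof -
  obtain H \<phi> where H: "subgraph H (complete_graph p)" "card (f ` edges H) \<le> 2"
    and \<phi>: "bij_betw \<phi> (verts (book n)) (verts H)" "edges H = (`) \<phi> ` edges (book n)"
    using assms unfolding contains_colored_copy_def isomorphic_def by blast
  define x y z where xyz: "x = \<phi> (Inl 0)" "y = \<phi> (Inl 1)" "z = (\<lambda>k. \<phi> (Inr k))"
  have eH: "edges H = insert {x, y} ((\<lambda>k. {x, z k}) ` {..<n} \<union> (\<lambda>k. {y, z k}) ` {..<n})"
    unfolding \<phi>(2) edges_book xyz by (simp add: image_Un image_image)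
  then have "finite (f ` edges H)" by simp
  have "\<not> {1..3} \<subseteq> f ` edges H"
    using card_mono[OF \<open>finite (f ` edges H)\<close>, of "{1..3}"] H(2) by auto
  then obtain i where i: "i \<in> {1..3}" "i \<notin> f ` edges H" by blast
  have "edges H \<subseteq> edges (complete_graph p)" using H(1) unfolding subgraph_def by blast
  then have e: "{x, y} \<in> edges (complete_graph p)"
      "\<And>k. k < n \<Longrightarrow> {x, z k} \<in> edges (complete_graph p)"
      "\<And>k. k < n \<Longrightarrow> {y, z k} \<in> edges (complete_graph p)"
    unfolding eH by auto
  have col: "f {x, y} \<noteq> i" "\<And>k. k < n \<Longrightarrow> f {x, z k} \<noteq> i" "\<And>k. k < n \<Longrightarrow> f {y, z k} \<noteq> i"
    using i(2) unfolding eH by auto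
  have "z ` {..<n} \<subseteq> pages p f i x y"
    using e(2,3) col(2,3) unfolding pages_def edges_complete_graph_iff by auto
  moreover have "card (z ` {..<n}) = n"
  proof -
    have "inj_on \<phi> (verts (book n))" using \<phi>(1) by (rule bij_betw_imp_inj_on)
    then have "inj_on z {..<n}" unfolding xyz verts_book inj_on_def by auto
    then show ?thesis by (simp add: card_image)
  qed
  ultimately have "n \<le> card (pages p f i x y)" using card_mono[OF finite_pages] by metis
  then show thesis using that e(1) i(1) col(1) unfolding edges_complete_graph_iff by blast
qed

text \<open>The spine and any \<open>n\<close> of the pages form a copy whose colors lie in
  \<open>{1..3} - {i}\<close>.\<close>

lemma contains_bookI:
  assumes f: "coloring 3 p f" and xy: "x < p" "y < p" "x \<noteq> y" and i: "i \<in> {1..3}" "f {x, y} \<noteq> i"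
    and n: "n \<le> card (pages p f i x y)"
  shows "contains_colored_copy 2 p f (book n)"
proof -
  obtain Z where Z: "Z \<subseteq> pages p f i x y" "card Z = n"
    using obtain_subset_with_card_n[OF n] by blast
  have "finite Z" using Z(1) finite_pages finite_subset by blast
  then obtain z where z: "bij_betw z {..<n} Z"
    using ex_bij_betw_nat_finite[of Z] Z(2) atLeast0LessThan by metis
  have zZ: "z k \<in> Z" if "k < n" for k using z that unfolding bij_betw_def by auto
  have zk: "z k < p" "z k \<noteq> x" "z k \<noteq> y" "f {x, z k} \<noteq> i" "f {y, z k} \<noteq> i" if "k < n" for k
    using zZ[OF that] Z(1) unfolding pages_def by auto
  have kz: "x \<noteq> z k" "y \<noteq> z k" if "k < n" for k
    using zk(2,3)[OF that] by simp_all
  \<comment> \<open>On the left only 0 and 1 occur, so the else branch is the spine end 1.\<close>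
  define \<phi> where "\<phi> = case_sum (\<lambda>a. if a = (0::nat) then x else y) z"
  define H where "H = ({x, y} \<union> Z, (`) \<phi> ` edges (book n))"
  have eH: "edges H = insert {x, y} ((\<lambda>k. {x, z k}) ` {..<n} \<union> (\<lambda>k. {y, z k}) ` {..<n})"
    unfolding H_def edges_book \<phi>_def by (simp add: image_Un image_image)
  have sub: "edges H \<subseteq> edges (complete_graph p)"
    unfolding eH using xy zk(1) kz by (auto simp: edges_complete_graph_iff)
  have "bij_betw \<phi> (verts (book n)) (verts H)"
    unfolding bij_betw_def
  proof
    show "inj_on \<phi> (verts (book n))"
      using xy zk(2,3) bij_betw_imp_inj_on[OF z]
      unfolding inj_on_def verts_book \<phi>_def by (auto; metis)
    show "\<phi> ` verts (book n) = verts H"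
      using z unfolding verts_book \<phi>_def H_def bij_betw_def by (auto simp: image_image)
  qed
  then have "isomorphic (book n) H" unfolding isomorphic_def H_def by auto
  moreover have "subgraph H (complete_graph p)"
    unfolding subgraph_def simple_graph_def
  proof (intro conjI ballI)
    show "verts H \<subseteq> verts (complete_graph p)"
      using xy Z(1) unfolding H_def complete_graph_def pages_def by auto
    show "edges H \<subseteq> edges (complete_graph p)" by (rule sub)
    fix e assume e: "e \<in> edges H"
    show "e \<subseteq> verts H" using e zZ unfolding eH by (auto simp: H_def)
    show "card e = 2" using e xy kz unfolding eH by (auto simp: card_insert_if)
  qed
  moreover have "f ` edges H \<subseteq> {1..3} - {i}"
  proof
    fix u assume "u \<in> f ` edges H"
    then obtain e where e: "e \<in> edges H" "u = f e" by blast
    then have "u \<in> {1..3}" using sub f unfolding coloring_def by blast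
    moreover have "u \<noteq> i" using e i(2) zk(4,5) unfolding eH by auto
    ultimately show "u \<in> {1..3} - {i}" by simp
  qed
  then have "card (f ` edges H) \<le> card ({1..3} - {i})" by (intro card_mono) auto
  then have "card (f ` edges H) \<le> 2" using i(1) by simp
  ultimately show ?thesis unfolding contains_colored_copy_def by blast
qed

lemma gallai_on_of_gallai_coloring:
  assumes "gallai_coloring t p f"
  shows "gallai_on {..<p} (\<lambda>x y. f {x, y})"
  using assms unfolding gallai_coloring_def rainbow_triangle_def gallai_on_def complete_graph_def
  by (auto simp: insert_commute)

lemma gallai_coloring_25_contains_book:
  assumes "gallai_coloring 3 25 f"
  shows "contains_colored_copy 2 25 f (book 15)"
proof (rule ccontr)
  assume no: "\<not> contains_colored_copy 2 25 f (book 15)"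
  define c where "c = (\<lambda>x y. f {x, y})"
  have f: "coloring 3 25 f" using assms unfolding gallai_coloring_def by blast
  have K: "{1..3} = {1, 2, 3::nat}" by auto
  have nine: "nb_union_ge {..<25} c i 9" if i: "i \<in> {1, 2, 3}" for i
    unfolding nb_union_ge_def
  proof (intro ballI impI)
    fix x y :: nat assume xy: "x \<in> {..<25}" "y \<in> {..<25}" "x \<noteq> y" "c x y \<noteq> i"
    let ?N = "nb {..<25} c i x \<union> nb {..<25} c i y"
    have "card (pages 25 f i x y) \<le> 14"
      using contains_bookI[OF f _ _ xy(3), of i 15] no xy i unfolding K c_def by force
    moreover have "{..<25} - {x, y} = pages 25 f i x y \<union> ?N"
      using xy(3,4) unfolding pages_def nb_def c_def by (auto simp: insert_commute)
    then have "card ({..<25} - {x, y}) \<le> card (pages 25 f i x y) + card ?N"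
      using card_Un_le[of "pages 25 f i x y" ?N] by simp
    moreover have "card ({..<25} - {x, y}) = 23"
      using xy by (simp add: card_Diff_subset)
    ultimately show "9 \<le> card ?N" by linarith
  qed
  show False
  proof (rule no_gallai_nb_union_ge_25[OF _ _ _ refl _ _ _ _ nine])
    show "gallai_on {..<25} c"
      using gallai_on_of_gallai_coloring[OF assms] unfolding c_def .
    show "c x y \<in> {1, 2, 3}" if "x \<in> {..<25}" "y \<in> {..<25}" "x \<noteq> y" for x y
      using coloring_range[OF f, of x y] that unfolding c_def K by auto
  qed auto
qed

section \<open>The lower bound\<close>

text \<open>Two copies of the Paley graph on 13 vertices minus a vertex, as colors 2 and 3, joined in
  color 1. In the Paley coloring of order 13 every edge lies in exactly two monochromatic
  triangles.\<close>

definition paley_edge :: "int \<Rightarrow> int \<Rightarrow> bool" where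
  "paley_edge u v \<longleftrightarrow>
     (let d = (u - v) mod 13 in d = 1 \<or> d = 3 \<or> d = 4 \<or> d = 9 \<or> d = 10 \<or> d = 12)"

text \<open>Residue 12 is the deleted vertex: 0 to 11 carry one copy, and 12 to 23 the other,
  shifted by 12.\<close>

definition paley_color :: "int \<Rightarrow> int \<Rightarrow> int" where
  "paley_color x y =
     (if x < 12
      then if y < 12 then if paley_edge x y then 2 else 3 else 1
      else if y < 12 then 1 else if paley_edge (x - 12) (y - 12) then 2 else 3)"

text \<open>\<open>Min\<close> and \<open>Max\<close> recover the two ends from the unordered
  edge.\<close>

definition paley_join :: "nat set \<Rightarrow> nat" where
  "paley_join e = nat (paley_color (int (Min e)) (int (Max e)))"

text \<open>A finite check by evaluation. The bound 14 is for an edge of color 2 or 3 avoiding the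
  other of these: 12 vertices of the opposite copy and at most 2 of its own. Avoiding color 1 leaves
  10 pages, and an edge of color 1 has at most 12.\<close>

lemma paley_color_pages:
  "list_all (\<lambda>x. list_all (\<lambda>y. paley_color x y = paley_color y x \<and> (x = y \<or>
     list_all (\<lambda>i. i = paley_color x y \<or>
       length (filter (\<lambda>z. z \<noteq> x \<and> z \<noteq> y \<and> paley_color x z \<noteq> i \<and> paley_color y z \<noteq> i) [0..23])
         \<le> 14) [1, 2, 3])) [0..23]) [0..23]"
  by code_simp

lemma paley_color_values: "paley_color x y \<in> {1, 2, 3}"
  unfolding paley_color_def by simp

lemma paley_join_lt: "x < y \<Longrightarrow> paley_join {x, y} = nat (paley_color (int x) (int y))"
  unfolding paley_join_def by simp

lemma paley_join_cross:
  assumes "x \<noteq> y"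
  shows "paley_join {x, y} \<in> (if (x < 12) = (y < 12) then {2, 3} else {1})"
  using assms
proof (induction x y rule: linorder_wlog)
  case (le x y)
  then show ?case by (auto simp: paley_join_lt paley_color_def)
next
  case (sym x y)
  then show ?case by (auto simp: insert_commute)
qed

text \<open>A triangle inside a copy sees only colors 2 and 3, and any other triangle has two edges
  of color 1. This works for every \<open>p\<close>, as all vertices from 12 on count as the second
  class.\<close>

lemma gallai_coloring_paley_join: "gallai_coloring 3 p paley_join"
proof -
  have "coloring 3 p paley_join"
    unfolding coloring_def
  proof
    fix e assume "e \<in> edges (complete_graph p)"
    then obtain u v where "e = {u, v}" "u \<noteq> v" unfolding complete_graph_def by auto
    then show "paley_join e \<in> {1..3}"
      using paley_join_cross[of u v] by (auto split: if_splits)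
  qed
  moreover have "\<not> rainbow_triangle p paley_join"
  proof
    assume "rainbow_triangle p paley_join"
    then obtain x y z where "x \<noteq> y" "x \<noteq> z" "y \<noteq> z" "paley_join {x, y} \<noteq> paley_join {x, z}"
      "paley_join {x, y} \<noteq> paley_join {y, z}" "paley_join {x, z} \<noteq> paley_join {y, z}"
      unfolding rainbow_triangle_def by blast
    then show False
      using paley_join_cross[of x y] paley_join_cross[of x z] paley_join_cross[of y z]
      by (auto split: if_splits)
  qed
  ultimately show ?thesis unfolding gallai_coloring_def by blast
qed

text \<open>Transfers the evaluated check from lists of integers to sets of naturals.\<close>

lemma card_pages_paley_join:
  assumes xy: "x < 24" "y < 24" "x \<noteq> y" and i: "i \<in> {1..3}" "paley_join {x, y} \<noteq> i"
  shows "card (pages 24 paley_join i x y) \<le> 14"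
proof -
  have sym: "paley_color (int u) (int v) = paley_color (int v) (int u)" if "u < 24" "v < 24" for u v
    using paley_color_pages that by (simp add: list_all_iff)
  have eq: "paley_color (int u) (int v) = int (paley_join {u, v})"
    if "u < 24" "v < 24" "u \<noteq> v" for u v
  proof -
    have "0 \<le> paley_color (int u) (int v)" using paley_color_values[of "int u" "int v"] by auto
    then show ?thesis
      using that sym[OF that(1,2)] paley_join_lt[of u v] paley_join_lt[of v u]
      by (cases "u < v") (auto simp: insert_commute)
  qed
  let ?L = "filter (\<lambda>z. z \<noteq> int x \<and> z \<noteq> int y \<and> paley_color (int x) z \<noteq> int i
    \<and> paley_color (int y) z \<noteq> int i) [0..23]"
  have "int i \<in> {1, 2, 3}" using i(1) by auto
  moreover have "int i \<noteq> paley_color (int x) (int y)" using i(2) eq[OF xy] by simp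
  ultimately have "length ?L \<le> 14"
    using bspec[OF bspec[OF paley_color_pages[unfolded list_all_iff set_upto list.set]],
        of "int x" "int y"] xy by auto
  have "int ` pages 24 paley_join i x y \<subseteq> set ?L"
    using eq xy unfolding pages_def by auto
  then have "card (int ` pages 24 paley_join i x y) \<le> card (set ?L)" by (rule card_mono[OF finite_set])
  also have "\<dots> \<le> 14" using card_length[of ?L] \<open>length ?L \<le> 14\<close> by linarith
  finally show ?thesis by (simp add: card_image)
qed

text \<open>Pages only grow with the order, so the check at order 24 settles every smaller order, as
  minimality requires.\<close>

lemma paley_join_no_book:
  assumes "p \<le> 24"
  shows "\<not> contains_colored_copy 2 p paley_join (book 15)"
proof
  assume "contains_colored_copy 2 p paley_join (book 15)"
  then obtain x y i where xy: "x < p" "y < p" "x \<noteq> y" "i \<in> {1..3}" "paley_join {x, y} \<noteq> i"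
    and card: "15 \<le> card (pages p paley_join i x y)" by (rule contains_bookD)
  have "pages p paley_join i x y \<subseteq> pages 24 paley_join i x y"
    using assms unfolding pages_def by auto
  then have "card (pages p paley_join i x y) \<le> card (pages 24 paley_join i x y)"
    by (intro card_mono) auto
  then show False using card card_pages_paley_join[of x y i] xy assms by linarith
qed

theorem theorem4p11: "weakened_gallai_ramsey 3 2 (book 15) = 25"
  unfolding weakened_gallai_ramsey_def
proof (rule Least_equality)
  show "\<forall>f. gallai_coloring 3 25 f \<longrightarrow> contains_colored_copy 2 25 f (book 15)"
    using gallai_coloring_25_contains_book by blast
  fix p assume "\<forall>f. gallai_coloring 3 p f \<longrightarrow> contains_colored_copy 2 p f (book 15)"
  then have "contains_colored_copy 2 p paley_join (book 15)"
    using gallai_coloring_paley_join by blast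
  then show "25 \<le> p" using paley_join_no_book[of p] by linarith
qed

end
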